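(* Let $\delta>0$, let $r_{\mathrm R}(x)=e^{-\delta x}$ for $x\ge0$, let $r_{\mathrm L}$ be arbitrary as in the context, and let $\gamma\in\mathbb{R}$, $\alpha=(\gamma+\delta)/\delta$, $B=\Phi(\gamma)/\phi(\gamma)$, $\varepsilon=1-R_{\mathrm T}(0)$. Let $t=-\gamma B/(1+\gamma B)>0$ in cases (i) and (ii) below. Then the unique solution $\eta^{\mathrm{opt}}\ge0$ of the threshold equation $r(\eta)=R_{\mathrm T}(\eta)$ is $$\eta^{\mathrm{opt}}=-\frac1\delta\ln\bigl(1-w(\varepsilon)\bigr),$$ where $w(\varepsilon)$ is given as follows (in each case the first equality gives $w(\varepsilon)$, and the series expansion holds for $\varepsilon$ in the indicated range). (i) If $\alpha=-1$: $$w(\varepsilon)=\tfrac12t\Bigl(\sqrt{(1+\varepsilon)^2+\tfrac{4\varepsilon}{t}}-1-\varepsilon\Bigr)=\varepsilon-\tfrac12t\sum_{k=2}^\infty(-1)^k\frac{P_k\bigl(1+\frac2t\bigr)-P_{k-2}\bigl(1+\frac2t\bigr)}{2k-1}\varepsilon^k,$$ the series being valid for $|\varepsilon|<1+\frac2t-\sqrt{\bigl(1+\frac2t\bigr)^2-1}$, where $P_k$ is the Legendre polynomial of degree $k$. (ii) If $\alpha=\frac12$: $$w(\varepsilon)=\frac{2t}{1+\gamma B}\Bigl(\sqrt{1+\frac{\varepsilon}{t}}-1\Bigr)-t\varepsilon=\varepsilon+\frac{2t}{1+\gamma B}\sum_{k=2}^\infty\binom{1/2}{k}\Bigl(\frac{\varepsilon}{t}\Bigr)^k,$$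 the series being valid for $|\varepsilon|<t$. (iii) If $\alpha=2$: $$w(\varepsilon)=-\gamma B+\sqrt{(\gamma B)^2+2\gamma B\varepsilon}=\varepsilon+\gamma B\sum_{k=2}^\infty\binom{1/2}{k}\Bigl(\frac{2\varepsilon}{\gamma B}\Bigr)^k,$$ the series being valid for $|\varepsilon|<\frac12\gamma B$.
   Context: $\phi,\Phi$ are the standard normal density and distribution function. $r:\mathbb{R}\to[0,1]$ equals $r_{\mathrm L}$ on $(-\infty,0]$ and $r_{\mathrm R}$ on $[0,\infty)$, where $r_{\mathrm L}:(-\infty,0]\to[0,1]$ is continuous, piecewise smooth, nondecreasing, with $r_{\mathrm L}(0)=1$ and $r_{\mathrm L}$ not identically $1$. For $\eta\ge0$, $$R_{\mathrm T}(\eta)=\frac{\int_{-\infty}^0 r_{\mathrm L}(x)e^{-\frac12x^2-\gamma x}\,dx+\int_0^\eta r(x)e^{-\gamma x}\,dx}{\frac{\Phi(\gamma)}{\phi(\gamma)}+\int_0^\eta e^{-\gamma x}\,dx}.$$ *)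

theory Defs
  imports "HOL-Probability.Probability" "HOL-Computational_Algebra.Polynomial"
begin

definition std_normal_cdf :: "real \<Rightarrow> real" where
  "std_normal_cdf = cdf std_normal_distribution"

(* Only values of f on the nonpositive half-line are constrained. The breakpoints may
   accumulate only at minus infinity, and the pieces need only be C1. *)
definition piecewise_smooth_nonpos :: "(real \<Rightarrow> real) \<Rightarrow> bool" where
  "piecewise_smooth_nonpos f \<longleftrightarrow> (\<forall>a. f piecewise_C1_differentiable_on {a..0})"

definition left_response :: "(real \<Rightarrow> real) \<Rightarrow> bool" where
  "left_response rL \<longleftrightarrow>
     (\<forall>x\<le>0. rL x \<in> {0..1}) \<and>
     continuous_on {..0} rL \<and>
     piecewise_smooth_nonpos rL \<and>
     mono_on {..0} rL \<and>
     rL 0 = 1 \<and>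
     (\<exists>x\<le>0. rL x \<noteq> 1)"

definition R_T :: "real \<Rightarrow> (real \<Rightarrow> real) \<Rightarrow> (real \<Rightarrow> real) \<Rightarrow> real \<Rightarrow> real" where
  "R_T \<gamma> rL r \<eta> =
     ((LINT x:{..0}|lborel. rL x * exp (- (1/2) * x\<^sup>2 - \<gamma> * x)) +
      (LINT x:{0..\<eta>}|lborel. r x * exp (- \<gamma> * x))) /
     (std_normal_cdf \<gamma> / std_normal_density \<gamma> + (LINT x:{0..\<eta>}|lborel. exp (- \<gamma> * x)))"

definition threshold_solution :: "real \<Rightarrow> (real \<Rightarrow> real) \<Rightarrow> (real \<Rightarrow> real) \<Rightarrow> real \<Rightarrow> bool" where
  "threshold_solution \<gamma> rL r \<eta> \<longleftrightarrow> \<eta> \<ge> 0 \<and> r \<eta> = R_T \<gamma> rL r \<eta>"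

definition eta_opt :: "real \<Rightarrow> (real \<Rightarrow> real) \<Rightarrow> (real \<Rightarrow> real) \<Rightarrow> real" where
  "eta_opt \<gamma> rL r = (THE \<eta>. threshold_solution \<gamma> rL r \<eta>)"

(* Legendre polynomials by Bonnet's recursion
   (n + 2) P_{n+2}(x) = (2n + 3) x P_{n+1}(x) - (n + 1) P_n(x). *)
fun legendre_poly :: "nat \<Rightarrow> real poly" where
  "legendre_poly 0 = 1"
| "legendre_poly (Suc 0) = [:0, 1:]"
| "legendre_poly (Suc (Suc n)) =
     smult (1 / (real n + 2))
       (smult (2 * real n + 3) ([:0, 1:] * legendre_poly (Suc n))
        - smult (real n + 1) (legendre_poly n))"

end

theory Submission
  imports Defs "HOL-Analysis.Generalised_Binomial_Theorem"
begin

text \<open>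
  Write \<open>A\<close> for the integral of \<open>r\<^sub>L\<close> against \<open>exp (- x\<^sup>2 / 2 - \<gamma> x)\<close> over the nonpositive
  half-line and \<open>E\<^sub>c(\<eta>)\<close> for the integral of \<open>exp (- c x)\<close> over \<open>[0, \<eta>]\<close>. Completing the square
  shows that the Mills ratio \<open>B = \<Phi>(\<gamma>) / \<phi>(\<gamma>)\<close> is the same integral as \<open>A\<close> with \<open>r\<^sub>L\<close> replaced
  by \<open>1\<close>; hence \<open>0 \<le> A \<le> B\<close>, and \<open>\<epsilon> = 1 - A / B\<close> lies in \<open>[0, 1]\<close>. After multiplication by
  its denominator the threshold equation reads
  \<open>A + E\<^sub>\<gamma>\<^sub>+\<^sub>\<delta>(\<eta>) = exp (- \<delta> \<eta>) (B + E\<^sub>\<gamma>(\<eta>))\<close>.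
  The difference of the two sides has derivative \<open>\<delta> exp (- \<delta> \<eta>) (B + E\<^sub>\<gamma>(\<eta>)) > 0\<close>, is \<open>A - B \<le> 0\<close> at
  \<open>0\<close> and is eventually positive, so there is exactly one solution
  (\<open>exponential_balance_ex1\<close>). It therefore suffices to check that the proposed \<open>\<eta>\<close> solves the
  equation.

  In each of the three cases \<open>\<gamma>\<close> and \<open>\<gamma> + \<delta>\<close> are nonzero integer multiples of \<open>\<delta> / 2\<close>, so the
  equation is algebraic in \<open>1 - w = exp (- \<delta> \<eta>)\<close> (or in its square root when \<open>\<alpha> = 1/2\<close>). With
  that quantity written as \<open>1 - v\<close>, it is a quadratic \<open>v\<^sup>2 + 2 p v = q\<close> whose nonnegative root
  \<open>sqrt (p\<^sup>2 + q) - p\<close> is less than \<open>1\<close> (\<open>quadratic_root_bounds\<close>). The coefficients involve \<open>t\<close>, which is positive for \<open>\<gamma> < 0\<close> because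
  \<open>1 + \<gamma> B > 0\<close> (\<open>mills_ratio_lower_bound\<close>).

  The expansions for \<open>\<alpha> = 1/2\<close> and \<open>\<alpha> = 2\<close> are the binomial series of the square root. For
  \<open>\<alpha> = -1\<close> the square root is that of \<open>1 + 2 x e + e\<^sup>2\<close>, with \<open>x = 1 + 2 / t\<close>. This factors as
  \<open>(1 + (x + s) e) (1 + (x - s) e)\<close> with \<open>s = sqrt (x\<^sup>2 - 1)\<close>, so on the stated range, which is
  \<open>|(x + s) e| < 1\<close>, its root is the Cauchy product of two binomial series. A first-order linear
  differential equation for the product, read on formal power series, gives a three-term recurrence
  for the coefficients, which the differences of Legendre polynomials in the expansion satisfy too
  (\<open>sqrt_quadratic_legendre_tail\<close>).
\<close>

section \<open>The Mills ratio and the integral over the nonpositive half-line\<close>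

text \<open>
  Completing the square: the kernel at \<open>x\<close> is \<open>\<phi>(\<gamma> + x) / \<phi>(\<gamma>)\<close>, so a translation by \<open>\<gamma>\<close> turns
  the integral over the nonpositive half-line into \<open>\<Phi>(\<gamma>) / \<phi>(\<gamma>)\<close>.
\<close>

lemma set_integral_mills_kernel:
  fixes \<gamma> :: real
  shows "set_integrable lborel {..0} (\<lambda>x. exp (- (1/2) * x\<^sup>2 - \<gamma> * x))"
    and "(LINT x:{..0}|lborel. exp (- (1/2) * x\<^sup>2 - \<gamma> * x))
           = std_normal_cdf \<gamma> / std_normal_density \<gamma>"
proof -
  let ?\<phi> = "std_normal_density"
  have pos: "?\<phi> \<gamma> > 0" by (simp add: normal_density_pos)
  have shift: "exp (- (1/2) * x\<^sup>2 - \<gamma> * x) = ?\<phi> (\<gamma> + x) / ?\<phi> \<gamma>" for x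
    by (simp add: std_normal_density_def exp_diff [symmetric] power2_eq_square field_simps
        flip: exp_add)
  have ind: "indicat_real {..0} x = indicat_real {..\<gamma>} (\<gamma> + x)" for x
    by (simp add: indicator_def)
  have int: "set_integrable lborel {..\<gamma>} ?\<phi>"
    unfolding set_integrable_def by (intro integrable_mult_indicator) auto
  from lborel_integrable_real_affine [OF int [unfolded set_integrable_def], of 1 \<gamma>]
  have int': "integrable lborel (\<lambda>x. indicat_real {..\<gamma>} (\<gamma> + x) * ?\<phi> (\<gamma> + x))"
    by simp
  then show "set_integrable lborel {..0} (\<lambda>x. exp (- (1/2) * x\<^sup>2 - \<gamma> * x))"
    unfolding set_integrable_def shift ind by simp
  have "std_normal_cdf \<gamma> = measure (density lborel ?\<phi>) {..\<gamma>}"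
    by (simp add: std_normal_cdf_def cdf_def)
  also have "\<dots> = (LINT x|density lborel ?\<phi>. indicat_real {..\<gamma>} x)"
    by simp
  also have "\<dots> = (LINT x|lborel. indicat_real {..\<gamma>} x * ?\<phi> x)"
    by (subst integral_density) (auto simp: mult.commute)
  also have "\<dots> = (LINT x|lborel. indicat_real {..\<gamma>} (\<gamma> + x) * ?\<phi> (\<gamma> + x))"
    by (subst lborel_integral_real_affine [where c = 1 and t = \<gamma>]) auto
  finally show "(LINT x:{..0}|lborel. exp (- (1/2) * x\<^sup>2 - \<gamma> * x))
           = std_normal_cdf \<gamma> / ?\<phi> \<gamma>"
    unfolding set_lebesgue_integral_def shift ind by simp
qed

text \<open>
  Up to the factor \<open>1 / c\<close> and the reflection \<open>x \<mapsto> - x\<close>, the integrand is the density of the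
  exponential distribution with rate \<open>c\<close>.
\<close>

lemma set_integral_exp_nonpos:
  fixes c :: real
  assumes "c > 0"
  shows "set_integrable lborel {..0} (\<lambda>x. exp (c * x))"
    and "(LINT x:{..0}|lborel. exp (c * x)) = 1 / c"
proof -
  have "has_bochner_integral lborel (exponential_density c) 1"
    using nn_integral_erlang_ith_moment [OF assms, of 0 0] assms
    by (intro has_bochner_integral_nn_integral) auto
  from has_bochner_integral_mult_right [OF this, of "1 / c"]
  have "has_bochner_integral lborel (\<lambda>x. indicat_real {0..} x * exp (- c * x)) (1 / c)"
    using assms
    by (subst (asm) has_bochner_integral_cong
        [where g = "\<lambda>x. indicat_real {0..} x * exp (- c * x)", OF refl _ refl])
       (auto simp: exponential_density_def indicator_def mult.commute)
  then have "has_bochner_integral lborel (\<lambda>x. indicat_real {..0} x * exp (c * x)) (1 / c)"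
    by (subst lborel_has_bochner_integral_real_affine_iff [of "-1" _ _ 0])
       (auto simp: indicator_def cong: has_bochner_integral_cong)
  then show "set_integrable lborel {..0} (\<lambda>x. exp (c * x))"
    and "(LINT x:{..0}|lborel. exp (c * x)) = 1 / c"
    by (simp_all add: set_integrable_def set_lebesgue_integral_def has_bochner_integral_iff)
qed

text \<open>
  Equality of the integrals would force \<open>f = g\<close> almost everywhere on \<open>S\<close>, and hence make a
  nondegenerate interval a null set.
\<close>

lemma set_integral_strict_mono_interval:
  fixes f g :: "real \<Rightarrow> real"
  assumes f: "set_integrable lborel S f" and g: "set_integrable lborel S g"
    and le: "\<And>x. x \<in> S \<Longrightarrow> f x \<le> g x"
    and ab: "a < b" "{a..b} \<subseteq> S" and less: "\<And>x. x \<in> {a..b} \<Longrightarrow> f x < g x"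
  shows "(LINT x:S|lborel. f x) < (LINT x:S|lborel. g x)"
proof (rule ccontr)
  let ?h = "\<lambda>x. indicat_real S x * (g x - f x)"
  assume "\<not> ?thesis"
  moreover have h: "integrable lborel ?h"
    and eq: "integral\<^sup>L lborel ?h = (LINT x:S|lborel. g x) - (LINT x:S|lborel. f x)"
    using set_integral_diff [OF g f] by (simp_all add: set_integrable_def set_lebesgue_integral_def)
  moreover have nn: "AE x in lborel. 0 \<le> ?h x"
    by (rule AE_I2) (auto simp: indicator_def le)
  moreover have "0 \<le> integral\<^sup>L lborel ?h" using nn by (rule integral_nonneg_AE)
  ultimately have "integral\<^sup>L lborel ?h = 0" by linarith
  then have "AE x in lborel. ?h x = 0"
    using integral_nonneg_eq_0_iff_AE [OF h nn] by blast
  then have "AE x in lborel. x \<notin> {a..b}"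
    by (rule AE_mp) (use ab less in \<open>force intro!: AE_I2 simp: indicator_def\<close>)
  then have "emeasure lborel {a..b} = 0"
    by (subst (asm) AE_iff_measurable [where N = "{a..b}"]) auto
  with ab show False by simp
qed

lemma mills_ratio_pos: "std_normal_cdf \<gamma> / std_normal_density \<gamma> > 0"
proof -
  have z: "set_integrable lborel {..0} (\<lambda>x::real. 0::real)"
    by (simp add: set_integrable_def)
  have "(LINT x:{..0::real}|lborel. (0::real)) < (LINT x:{..0}|lborel. exp (- (1/2) * x\<^sup>2 - \<gamma> * x))"
    by (rule set_integral_strict_mono_interval
        [OF z set_integral_mills_kernel(1), where a = "-1" and b = 0]) auto
  then show ?thesis by (simp only: set_integral_mills_kernel(2)) simp
qed

text \<open>
  For negative \<open>\<gamma>\<close>, dropping the factor \<open>exp (- x\<^sup>2 / 2) \<le> 1\<close> from the kernel bounds the Mills ratio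
  strictly by the integral of \<open>exp (- \<gamma> x)\<close>, which is \<open>- 1 / \<gamma>\<close>.
\<close>

lemma mills_ratio_lower_bound: "0 < 1 + \<gamma> * (std_normal_cdf \<gamma> / std_normal_density \<gamma>)"
proof (cases "\<gamma> < 0")
  case False
  then show ?thesis using mills_ratio_pos [of \<gamma>]
    by (intro add_pos_nonneg mult_nonneg_nonneg) simp_all
next
  case True
  then have g: "- \<gamma> > 0" by simp
  have "(LINT x:{..0}|lborel. exp (- (1/2) * x\<^sup>2 - \<gamma> * x)) < (LINT x:{..0}|lborel. exp (- \<gamma> * x))"
    by (rule set_integral_strict_mono_interval
        [OF set_integral_mills_kernel(1) set_integral_exp_nonpos(1) [OF g], where a = "-2" and b = "-1"])
       auto
  then have "std_normal_cdf \<gamma> / std_normal_density \<gamma> < 1 / - \<gamma>"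
    by (simp only: set_integral_mills_kernel(2) set_integral_exp_nonpos(2) [OF g])
  with g have "(- \<gamma>) * (std_normal_cdf \<gamma> / std_normal_density \<gamma>) < 1"
    by (simp add: field_simps)
  then show ?thesis by simp
qed

lemma left_integral_bounds:
  assumes "left_response rL"
  shows "0 \<le> (LINT x:{..0}|lborel. rL x * exp (- (1/2) * x\<^sup>2 - \<gamma> * x))"
    and "(LINT x:{..0}|lborel. rL x * exp (- (1/2) * x\<^sup>2 - \<gamma> * x))
           \<le> std_normal_cdf \<gamma> / std_normal_density \<gamma>"
proof -
  let ?k = "\<lambda>x. exp (- (1/2) * x\<^sup>2 - \<gamma> * x)"
  have rng: "0 \<le> rL x" "rL x \<le> 1" if "x \<le> 0" for x
    using assms that by (auto simp: left_response_def)
  show "0 \<le> (LINT x:{..0}|lborel. rL x * ?k x)"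
    unfolding set_lebesgue_integral_def
    by (intro integral_nonneg_AE AE_I2) (auto simp: indicator_def rng)
  have cont: "continuous_on {..0} (\<lambda>x. rL x * ?k x)"
    using assms by (auto simp: left_response_def intro!: continuous_intros)
  have "set_borel_measurable lborel {..0} (\<lambda>x. rL x * ?k x)"
    unfolding set_borel_measurable_def
    using borel_measurable_continuous_on_indicator [of "{..0}" "\<lambda>x. rL x * ?k x"] cont
    by simp
  then have "set_integrable lborel {..0} (\<lambda>x. rL x * ?k x)"
    by (rule set_integrable_bound [OF set_integral_mills_kernel(1) [of \<gamma>]])
       (auto simp: abs_mult rng intro!: AE_I2 mult_left_le_one_le)
  from set_integral_mono [OF this set_integral_mills_kernel(1) [of \<gamma>]]
  show "(LINT x:{..0}|lborel. rL x * ?k x) \<le> std_normal_cdf \<gamma> / std_normal_density \<gamma>"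
    unfolding set_integral_mills_kernel(2) by (auto simp: rng)
qed

section \<open>The threshold equation for an exponential response\<close>

text \<open>
  The integral of \<open>exp (- c x)\<close> over \<open>[0, \<eta>]\<close>, given in closed form so that it is differentiable on
  all of the real line, including at \<open>0\<close> and for \<open>c = 0\<close>.
\<close>

definition exp_primitive :: "real \<Rightarrow> real \<Rightarrow> real" where
  "exp_primitive c x = (if c = 0 then x else (1 - exp (- c * x)) / c)"

lemma exp_primitive_0 [simp]: "exp_primitive c 0 = 0"
  by (simp add: exp_primitive_def)

lemma DERIV_exp_primitive [derivative_intros]:
  "(f has_real_derivative d) (at x) \<Longrightarrow>
   ((\<lambda>x. exp_primitive c (f x)) has_real_derivative exp (- c * f x) * d) (at x)"
proof -
  assume *: "(f has_real_derivative d) (at x)"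
  have "(exp_primitive c has_real_derivative exp (- c * y)) (at y)" for y
    unfolding exp_primitive_def by (cases "c = 0") (auto intro!: derivative_eq_intros)
  from DERIV_chain2 [OF this *] show ?thesis .
qed

lemma set_integral_exp_Icc:
  assumes "\<eta> \<ge> 0"
  shows "(LINT x:{0..\<eta>}|lborel. exp (- c * x)) = exp_primitive c \<eta>"
proof -
  have "(LINT x:{0..\<eta>}|lborel. exp (- c * x)) = exp_primitive c \<eta> - exp_primitive c 0"
    unfolding set_lebesgue_integral_def
    by (rule integral_FTC_atLeastAtMost [OF assms])
       (auto intro!: continuous_intros DERIV_exp_primitive [THEN DERIV_subset, OF DERIV_ident, simplified]
             simp flip: has_real_derivative_iff_has_vector_derivative)
  then show ?thesis by simp
qed

lemma exp_primitive_nonneg: "x \<ge> 0 \<Longrightarrow> exp_primitive c x \<ge> 0"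
  by (subst set_integral_exp_Icc [symmetric])
     (auto simp: set_lebesgue_integral_def intro!: integral_nonneg_AE AE_I2)

text \<open>
  The difference \<open>F\<close> of the two sides is increasing, since the terms \<open>exp (- (\<gamma> + \<delta>) \<eta>)\<close> in its
  derivative cancel. Eventual positivity needs no distinction by the signs of \<open>\<gamma>\<close> and
  \<open>\<gamma> + \<delta>\<close>: one has \<open>F \<eta> = A + K \<eta> - B exp (- \<delta> \<eta>)\<close>, where \<open>K \<eta>\<close> is the integral of
  \<open>exp (- \<gamma> x) (exp (- \<delta> x) - exp (- \<delta> \<eta>))\<close> over \<open>[0, \<eta>]\<close>. This \<open>K\<close> is nondecreasing and \<open>K 1 > 0\<close>,
  while the last term tends to \<open>0\<close>.
\<close>

lemma exponential_balance_ex1: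
  fixes \<delta> \<gamma> A B :: real
  assumes \<delta>: "\<delta> > 0" and B: "B > 0" and A: "0 \<le> A" "A \<le> B"
  shows "\<exists>!\<eta>. \<eta> \<ge> 0 \<and> A + exp_primitive (\<gamma> + \<delta>) \<eta>
           = exp (- \<delta> * \<eta>) * (B + exp_primitive \<gamma> \<eta>)"
proof -
  define K where "K = (\<lambda>\<eta>. exp_primitive (\<gamma> + \<delta>) \<eta> - exp (- \<delta> * \<eta>) * exp_primitive \<gamma> \<eta>)"
  define F where "F = (\<lambda>\<eta>. A + K \<eta> - B * exp (- \<delta> * \<eta>))"
  have K': "(K has_real_derivative \<delta> * exp (- \<delta> * \<eta>) * exp_primitive \<gamma> \<eta>) (at \<eta>)" for \<eta>
    unfolding K_def
    by (auto intro!: derivative_eq_intros simp: algebra_simps simp flip: exp_add)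
  have F': "(F has_real_derivative \<delta> * exp (- \<delta> * \<eta>) * (B + exp_primitive \<gamma> \<eta>)) (at \<eta>)" for \<eta>
    unfolding F_def by (auto intro!: derivative_eq_intros K' simp: algebra_simps)
  have F_mono: "F x < F y" if "0 \<le> x" "x < y" for x y
    using that \<delta> B
    by (intro DERIV_pos_imp_increasing [of x y F])
       (auto intro!: exI F' mult_pos_pos add_pos_nonneg exp_primitive_nonneg)
  have K_mono: "K x \<le> K y" if "0 \<le> x" "x \<le> y" for x y
    using that \<delta>
    by (intro DERIV_nonneg_imp_nondecreasing [of x y K])
       (auto intro!: exI K' mult_nonneg_nonneg exp_primitive_nonneg)
  have prim_pos: "0 < exp_primitive \<gamma> x" if "0 < x" for x
    using DERIV_pos_imp_increasing [of 0 x "exp_primitive \<gamma>"] that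
      DERIV_exp_primitive [OF DERIV_ident] by fastforce
  have "0 < K 1"
  proof -
    have "K (1/2) < K 1"
      using \<delta> by (intro DERIV_pos_imp_increasing [of "1/2" 1 K]) (auto intro!: exI K' mult_pos_pos prim_pos)
    moreover have "K 0 \<le> K (1/2)" by (rule K_mono) auto
    ultimately show ?thesis by (simp add: K_def)
  qed
  \<comment> \<open>\<open>M\<close> is so large that \<open>B / K 1 \<le> \<delta> M < exp (\<delta> M)\<close>.\<close>
  define M where "M = max 1 (B / (\<delta> * K 1))"
  have "B * exp (- \<delta> * M) < K 1"
  proof -
    have "B \<le> \<delta> * M * K 1"
      using \<delta> \<open>0 < K 1\<close> by (simp add: M_def max_def field_simps)
    also have "\<dots> < exp (\<delta> * M) * K 1"
      using exp_ge_add_one_self [of "\<delta> * M"] \<open>0 < K 1\<close>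
      by (intro mult_strict_right_mono) linarith+
    finally have "B < exp (\<delta> * M) * K 1" .
    then show ?thesis by (simp add: exp_minus field_simps)
  qed
  moreover have "K 1 \<le> K M" by (rule K_mono) (auto simp: M_def)
  ultimately have FM: "0 \<le> F M" using A by (simp add: F_def)
  have F0: "F 0 \<le> 0" using A by (simp add: F_def K_def)
  have "0 \<le> M" by (simp add: M_def)
  then obtain \<eta> where \<eta>: "0 \<le> \<eta>" "F \<eta> = 0"
    using IVT' [of F 0 0 M] F0 FM DERIV_continuous_on [of "{0..M}" F, OF DERIV_subset [OF F']]
    by auto
  have "\<eta>' = \<eta>" if "0 \<le> \<eta>'" "F \<eta>' = 0" for \<eta>'
    using F_mono [of \<eta> \<eta>'] F_mono [of \<eta>' \<eta>] that \<eta> by (cases \<eta> \<eta>' rule: linorder_cases) auto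
  with \<eta> have "\<exists>!\<eta>. \<eta> \<ge> 0 \<and> F \<eta> = 0" by blast
  then show ?thesis by (simp add: F_def K_def algebra_simps)
qed

lemma threshold_solution_iff:
  fixes \<delta> \<gamma> :: real
  assumes r: "\<forall>x\<ge>0. r x = exp (- \<delta> * x)"
  defines "B \<equiv> std_normal_cdf \<gamma> / std_normal_density \<gamma>"
  shows "threshold_solution \<gamma> rL r \<eta> \<longleftrightarrow> \<eta> \<ge> 0 \<and>
    (LINT x:{..0}|lborel. rL x * exp (- (1/2) * x\<^sup>2 - \<gamma> * x)) + exp_primitive (\<gamma> + \<delta>) \<eta>
      = exp (- \<delta> * \<eta>) * (B + exp_primitive \<gamma> \<eta>)"
proof (cases "\<eta> \<ge> 0")
  case True
  have "(LINT x:{0..\<eta>}|lborel. r x * exp (- \<gamma> * x))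
      = (LINT x:{0..\<eta>}|lborel. exp (- (\<gamma> + \<delta>) * x))"
    by (rule set_lebesgue_integral_cong) (auto simp: r algebra_simps simp flip: exp_add)
  then have "(LINT x:{0..\<eta>}|lborel. r x * exp (- \<gamma> * x)) = exp_primitive (\<gamma> + \<delta>) \<eta>"
    by (simp only: set_integral_exp_Icc [OF True])
  moreover have "B + exp_primitive \<gamma> \<eta> > 0"
    using mills_ratio_pos [of \<gamma>] exp_primitive_nonneg [OF True, of \<gamma>] by (simp add: B_def)
  ultimately show ?thesis
    using True
    unfolding threshold_solution_def R_T_def set_integral_exp_Icc [OF True] r [rule_format, OF True]
      B_def [symmetric]
    by (subst eq_divide_eq) auto
qed (simp add: threshold_solution_def)

lemma R_T_at_zero:
  "R_T \<gamma> rL r 0 = (LINT x:{..0}|lborel. rL x * exp (- (1/2) * x\<^sup>2 - \<gamma> * x))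
                    / (std_normal_cdf \<gamma> / std_normal_density \<gamma>)"
proof -
  have "(LINT x:{0..0}|lborel. f x) = 0" for f :: "real \<Rightarrow> real"
  proof -
    have "AE x in lborel. indicat_real {0..0} x *\<^sub>R f x = 0"
      using AE_lborel_singleton [of "0::real"] by (rule eventually_mono) simp
    then show ?thesis
      unfolding set_lebesgue_integral_def by (rule integral_eq_zero_AE)
  qed
  then show ?thesis by (simp add: R_T_def)
qed

lemma threshold_solution_ex1:
  assumes "\<delta> > 0" "left_response rL" and r: "\<forall>x\<ge>0. r x = exp (- \<delta> * x)"
  shows "\<exists>!\<eta>. threshold_solution \<gamma> rL r \<eta>"
  unfolding threshold_solution_iff [where \<delta> = \<delta>, OF r]
  by (rule exponential_balance_ex1 [OF assms(1) mills_ratio_pos left_integral_bounds [OF assms(2)]])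

text \<open>
  By uniqueness it is enough that the proposed point balances the two sides; here \<open>1 - w\<close> is the
  value of \<open>exp (- \<delta> \<eta>)\<close>, and \<open>R_T \<gamma> rL r 0 * B\<close> is the integral over the nonpositive half-line.
\<close>

lemma eta_opt_eq_log:
  fixes \<delta> \<gamma> w :: real
  assumes "\<delta> > 0" "left_response rL" and r: "\<forall>x\<ge>0. r x = exp (- \<delta> * x)"
  defines "B \<equiv> std_normal_cdf \<gamma> / std_normal_density \<gamma>"
    and "\<eta> \<equiv> - (1 / \<delta>) * ln (1 - w)"
  assumes w: "0 \<le> w" "w < 1"
    and balance: "R_T \<gamma> rL r 0 * B + exp_primitive (\<gamma> + \<delta>) \<eta>
        = (1 - w) * (B + exp_primitive \<gamma> \<eta>)"
  shows "eta_opt \<gamma> rL r = \<eta>"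
proof -
  have "\<eta> \<ge> 0" using w assms(1) by (simp add: \<eta>_def divide_nonpos_pos)
  moreover have "exp (- \<delta> * \<eta>) = 1 - w" using w assms(1) by (simp add: \<eta>_def)
  ultimately have "threshold_solution \<gamma> rL r \<eta>"
    using balance mills_ratio_pos [of \<gamma>]
    unfolding threshold_solution_iff [where \<delta> = \<delta>, OF r] R_T_at_zero B_def [symmetric]
    by simp
  with threshold_solution_ex1 [OF assms(1,2) r] show ?thesis
    unfolding eta_opt_def by (rule the1_equality)
qed

section \<open>Algebraic solutions of the threshold equation\<close>

lemma exp_primitive_log:
  assumes "\<delta> > 0" "0 < y" "a \<noteq> 0"
  shows "exp_primitive (a * \<delta>) (- (1 / \<delta>) * ln y) = (1 - y powr a) / (a * \<delta>)"
  using assms by (simp add: exp_primitive_def powr_def)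

text \<open>
  The case \<open>\<alpha> = -1\<close>, in which \<open>\<gamma> = - 2 \<delta>\<close> and \<open>\<gamma> + \<delta> = - \<delta>\<close>. With \<open>y = 1 - w\<close> the primitives are
  rational in \<open>y\<close>, and multiplying the balance equation by \<open>2 \<delta> y\<close> makes it quadratic in \<open>y\<close>.
\<close>

lemma balance_neg_one:
  fixes \<delta> B \<epsilon> t w :: real
  assumes \<delta>: "\<delta> > 0" and D: "1 - 2 * \<delta> * B > 0" and w: "w < 1"
    and t: "t = 2 * \<delta> * B / (1 - 2 * \<delta> * B)"
    and quad: "w\<^sup>2 + t * (1 + \<epsilon>) * w = t * \<epsilon>"
  shows "(1 - \<epsilon>) * B + exp_primitive (- \<delta>) (- (1 / \<delta>) * ln (1 - w))
       = (1 - w) * (B + exp_primitive (- 2 * \<delta>) (- (1 / \<delta>) * ln (1 - w)))"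
proof -
  define y where "y = 1 - w"
  have y: "y > 0" "w = 1 - y" using w by (simp_all add: y_def)
  define g h where "g = exp_primitive (- \<delta>) (- (1 / \<delta>) * ln y)"
    and "h = exp_primitive (- 2 * \<delta>) (- (1 / \<delta>) * ln y)"
  have E: "\<delta> * g * y = 1 - y" "2 * \<delta> * h * y\<^sup>2 = 1 - y\<^sup>2"
    using exp_primitive_log [OF \<delta> y(1), of "-1"] exp_primitive_log [OF \<delta> y(1), of "-2"] y(1) \<delta>
    by (simp_all add: g_def h_def powr_minus powr_numeral divide_simps) (simp_all add: algebra_simps)
  have "(1 - 2 * \<delta> * B) * w\<^sup>2 + 2 * \<delta> * B * (1 + \<epsilon>) * w = 2 * \<delta> * B * \<epsilon>"
  proof -
    have "(1 - 2 * \<delta> * B) * t = 2 * \<delta> * B" using D t by simp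
    moreover have "(1 - 2 * \<delta> * B) * w\<^sup>2 + ((1 - 2 * \<delta> * B) * t) * (1 + \<epsilon>) * w
        = ((1 - 2 * \<delta> * B) * t) * \<epsilon>"
      using arg_cong [OF quad, of "\<lambda>z. (1 - 2 * \<delta> * B) * z"] by (simp add: algebra_simps)
    ultimately show ?thesis by simp
  qed
  then have main: "2 * \<delta> * (1 - \<epsilon>) * B * y + 2 * (1 - y) = 2 * \<delta> * B * y\<^sup>2 + (1 - y\<^sup>2)"
    unfolding y(2) by (simp add: algebra_simps power2_eq_square)
  have "2 * \<delta> * y * ((1 - \<epsilon>) * B + g) = 2 * \<delta> * (1 - \<epsilon>) * B * y + 2 * (\<delta> * g * y)"
    by (simp add: algebra_simps)
  also have "\<dots> = 2 * \<delta> * B * y\<^sup>2 + 2 * \<delta> * h * y\<^sup>2"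
    unfolding E by (rule main)
  also have "\<dots> = 2 * \<delta> * y * (y * (B + h))" by (simp add: algebra_simps power2_eq_square)
  finally show ?thesis using \<delta> y(1) by (simp add: y_def g_def h_def)
qed

text \<open>
  The case \<open>\<alpha> = 1/2\<close>, in which \<open>\<gamma> = - \<delta> / 2\<close> and \<open>\<gamma> + \<delta> = \<delta> / 2\<close>. The equation is quadratic in
  \<open>s = exp (- \<delta> \<eta> / 2)\<close>, so the natural unknown is \<open>v = 1 - s\<close> instead of \<open>w = 1 - s\<^sup>2\<close>.
\<close>

lemma balance_half:
  fixes \<delta> B \<epsilon> t v :: real
  assumes \<delta>: "\<delta> > 0" and D: "1 - \<delta> * B / 2 > 0" and v: "v < 1"
    and t: "t = (\<delta> * B / 2) / (1 - \<delta> * B / 2)"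
    and quad: "v\<^sup>2 + 2 * t * v = t * \<epsilon>"
  shows "(1 - \<epsilon>) * B + exp_primitive (\<delta> / 2) (- (1 / \<delta>) * ln ((1 - v)\<^sup>2))
       = (1 - v)\<^sup>2 * (B + exp_primitive (- \<delta> / 2) (- (1 / \<delta>) * ln ((1 - v)\<^sup>2)))"
proof -
  define s where "s = 1 - v"
  have s: "s > 0" "v = 1 - s" using v by (simp_all add: s_def)
  have root: "(s\<^sup>2) powr (1/2) = s" using s by (simp add: powr_half_sqrt)
  define g h where "g = exp_primitive (\<delta> / 2) (- (1 / \<delta>) * ln (s\<^sup>2))"
    and "h = exp_primitive (- \<delta> / 2) (- (1 / \<delta>) * ln (s\<^sup>2))"
  have E: "\<delta> * g = 2 * (1 - s)" "\<delta> * h * s = 2 * (1 - s)"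
    using exp_primitive_log [OF \<delta>, of "s\<^sup>2" "1/2"] exp_primitive_log [OF \<delta>, of "s\<^sup>2" "-1/2"] s \<delta> root
    by (simp_all add: g_def h_def powr_minus divide_simps) (simp_all add: algebra_simps)
  have "(1 - \<delta> * B / 2) * v\<^sup>2 + 2 * (\<delta> * B / 2) * v = (\<delta> * B / 2) * \<epsilon>"
  proof -
    have "(1 - \<delta> * B / 2) * t = \<delta> * B / 2"
      unfolding t using D by (intro nonzero_mult_div_cancel_left [THEN trans [OF times_divide_eq_right]]) simp
    moreover have "(1 - \<delta> * B / 2) * v\<^sup>2 + 2 * ((1 - \<delta> * B / 2) * t) * v
        = ((1 - \<delta> * B / 2) * t) * \<epsilon>"
      using arg_cong [OF quad, of "\<lambda>z. (1 - \<delta> * B / 2) * z"] by (simp only: distrib_left mult_ac)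
    ultimately show ?thesis by (simp only:)
  qed
  then have main: "\<delta> * (1 - \<epsilon>) * B + 2 * (1 - s) = \<delta> * B * s\<^sup>2 + 2 * (1 - s) * s"
    unfolding s(2) by (simp add: field_simps power2_eq_square)
  have "\<delta> * ((1 - \<epsilon>) * B + g) = \<delta> * (1 - \<epsilon>) * B + \<delta> * g"
    by (simp add: algebra_simps)
  also have "\<dots> = \<delta> * B * s\<^sup>2 + \<delta> * h * s * s"
    unfolding E by (rule main)
  also have "\<dots> = \<delta> * (s\<^sup>2 * (B + h))" by (simp add: algebra_simps power2_eq_square)
  finally show ?thesis using \<delta> by (simp add: s_def g_def h_def)
qed

text \<open>
  The case \<open>\<alpha> = 2\<close>, in which \<open>\<gamma> = \<delta>\<close> and \<open>\<gamma> + \<delta> = 2 \<delta>\<close>, so the primitives are polynomials in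
  \<open>y = 1 - w\<close>.
\<close>

lemma balance_two:
  fixes \<delta> B \<epsilon> w :: real
  assumes \<delta>: "\<delta> > 0" and w: "w < 1"
    and quad: "w\<^sup>2 + 2 * (\<delta> * B) * w = 2 * (\<delta> * B) * \<epsilon>"
  shows "(1 - \<epsilon>) * B + exp_primitive (2 * \<delta>) (- (1 / \<delta>) * ln (1 - w))
       = (1 - w) * (B + exp_primitive \<delta> (- (1 / \<delta>) * ln (1 - w)))"
proof -
  define y where "y = 1 - w"
  have y: "y > 0" "w = 1 - y" using w by (simp_all add: y_def)
  define g h where "g = exp_primitive (2 * \<delta>) (- (1 / \<delta>) * ln y)"
    and "h = exp_primitive \<delta> (- (1 / \<delta>) * ln y)"
  have E: "2 * \<delta> * g = 1 - y\<^sup>2" "\<delta> * h = 1 - y"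
    using exp_primitive_log [OF \<delta> y(1), of 2] exp_primitive_log [OF \<delta> y(1), of 1] y(1) \<delta>
    by (simp_all add: g_def h_def powr_numeral)
  have "2 * \<delta> * ((1 - \<epsilon>) * B + g) = 2 * \<delta> * (1 - \<epsilon>) * B + 2 * \<delta> * g"
    by (simp add: algebra_simps)
  also have "\<dots> = y * (2 * \<delta> * B + 2 * (\<delta> * h))"
    using quad unfolding E y(2) by (simp add: algebra_simps power2_eq_square)
  also have "\<dots> = 2 * \<delta> * (y * (B + h))" by (simp add: algebra_simps)
  finally show ?thesis using \<delta> by (simp add: y_def g_def h_def)
qed

text \<open>
  The bound \<open>q < 1 + 2 p\<close> says that \<open>w\<^sup>2 + 2 p w\<close> exceeds \<open>q\<close> already at \<open>w = 1\<close>, which puts the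
  root below \<open>1\<close>.
\<close>

lemma quadratic_root_bounds:
  fixes p q w :: real
  assumes "0 \<le> p" "0 \<le> q" "q < 1 + 2 * p" and w: "w = sqrt (p\<^sup>2 + q) - p"
  shows "0 \<le> w" "w < 1" "w\<^sup>2 + 2 * p * w = q"
proof -
  have "p \<le> sqrt (p\<^sup>2 + q)" using assms by (intro real_le_rsqrt) simp
  then show "0 \<le> w" by (simp add: w)
  have "sqrt (p\<^sup>2 + q) < p + 1"
    using assms by (intro real_less_lsqrt) (auto simp: power2_eq_square algebra_simps)
  then show "w < 1" by (simp add: w)
  have "(w + p)\<^sup>2 = p\<^sup>2 + q" using assms by (simp add: w)
  then show "w\<^sup>2 + 2 * p * w = q" by (simp add: power2_eq_square algebra_simps)
qed

section \<open>The binomial series of the square root\<close>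

lemma sqrt_binomial_sums:
  fixes z :: real
  assumes "\<bar>z\<bar> < 1"
  shows "(\<lambda>k. ((1/2) gchoose k) * z ^ k) sums sqrt (1 + z)"
  using gen_binomial_real [OF assms, of "1/2"] assms
  by (simp add: powr_half_sqrt)

lemma sqrt_binomial_tail:
  fixes z :: real
  assumes "\<bar>z\<bar> < 1"
  shows "(\<lambda>k. ((1/2) gchoose (k + 2)) * z ^ (k + 2)) sums (sqrt (1 + z) - 1 - z / 2)"
  using sums_split_initial_segment [OF sqrt_binomial_sums [OF assms], of 2]
  by (simp add: numeral_2_eq_2 algebra_simps)

lemma sqrt_binomial_summable_norm:
  fixes z :: real
  assumes "\<bar>z\<bar> < 1"
  shows "summable (\<lambda>k. norm (((1/2) gchoose k) * z ^ k))"
proof -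
  define K where "K = (1 + \<bar>z\<bar>) / 2"
  have K: "\<bar>K\<bar> < 1" "\<bar>z\<bar> < K" using assms by (auto simp: K_def)
  have "summable (\<lambda>k. ((1/2::real) gchoose k) * K ^ k)"
    using sqrt_binomial_sums [OF K(1)] by (rule sums_summable)
  then show ?thesis by (rule powser_insidea) (use K in auto)
qed

section \<open>Legendre polynomials and the square root of a quadratic\<close>

text \<open>
  The formal square root of \<open>1 + c X\<close>.
\<close>

definition fps_sqrt_linear :: "real \<Rightarrow> real fps" where
  "fps_sqrt_linear c = Abs_fps (\<lambda>k. ((1/2) gchoose k) * c ^ k)"

text \<open>
  Differentiating the square root of \<open>1 + c X\<close> and multiplying by \<open>1 + c X\<close> returns \<open>c / 2\<close> times that
  root. On coefficients this is
  \<open>(k + 1) (1/2 choose k + 1) = (1/2 - k) (1/2 choose k)\<close>.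
\<close>

lemma fps_sqrt_linear_deriv:
  "(1 + fps_const c * fps_X) * fps_deriv (fps_sqrt_linear c)
     = fps_const (c / 2) * fps_sqrt_linear c"
proof (rule fps_ext)
  fix k :: nat
  have rec: "real (Suc k) * ((1/2) gchoose (Suc k)) = (1/2 - real k) * ((1/2) gchoose k)" for k
    using gbinomial_absorption' [of "Suc k" "1/2::real"] gbinomial_mult_1 [of "1/2::real" k]
    by (simp add: algebra_simps)
  show "fps_nth ((1 + fps_const c * fps_X) * fps_deriv (fps_sqrt_linear c)) k =
        fps_nth (fps_const (c / 2) * fps_sqrt_linear c) k"
  proof (cases k)
    case 0
    then show ?thesis by (simp add: fps_sqrt_linear_def algebra_simps)
  next
    case (Suc m)
    have "fps_nth ((1 + fps_const c * fps_X) * fps_deriv (fps_sqrt_linear c)) k =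
       c ^ Suc k * (real (Suc k) * ((1/2) gchoose (Suc k))) + c ^ Suc k * (real k * ((1/2) gchoose k))"
      using Suc by (simp add: fps_sqrt_linear_def distrib_right mult.assoc)
        (simp add: algebra_simps)
    also have "\<dots> = c ^ Suc k * (1/2) * ((1/2) gchoose k)"
      unfolding rec by (simp add: algebra_simps)
    finally show ?thesis by (simp add: fps_sqrt_linear_def)
  qed
qed


lemma legendre_bonnet:
  "(real n + 2) * poly (legendre_poly (n + 2)) x =
     (2 * real n + 3) * x * poly (legendre_poly (n + 1)) x - (real n + 1) * poly (legendre_poly n) x"
  by (simp add: numeral_2_eq_2 field_simps)

text \<open>
  Bonnet's recursion converts the two-step difference of Legendre polynomials in the expansion into
  a combination of neighbours, which is the form in which the coefficient recurrence is easy to check.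
\<close>

lemma legendre_step_eq_difference:
  "(poly (legendre_poly n) x - x * poly (legendre_poly (n + 1)) x) / (real n + 2)
     = - ((poly (legendre_poly (n + 2)) x - poly (legendre_poly n) x) / (2 * real n + 3))"
  using legendre_bonnet [of n x]
  by (simp add: divide_simps del: legendre_poly.simps) (simp add: algebra_simps del: legendre_poly.simps)

text \<open>
  With \<open>c + d = - 2 x\<close> and \<open>c d = 1\<close> the product \<open>F\<close> is the formal square root of
  \<open>Q = 1 - 2 x X + X\<^sup>2\<close>, and the claim is \<open>Q F' = (Q' / 2) F\<close>, obtained from the equations of the two
  factors by the product rule.
\<close>

lemma fps_sqrt_linear_product_ode:
  fixes c d x :: real
  assumes "c + d = - 2 * x" "c * d = 1"
  defines "F \<equiv> fps_sqrt_linear c * fps_sqrt_linear d"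
  shows "(1 - fps_const (2 * x) * fps_X + fps_X * fps_X) * fps_deriv F
           = (fps_X - fps_const x) * F"
proof -
  define u where "u = 1 + fps_const c * fps_X"
  define v where "v = 1 + fps_const d * fps_X"
  have "u * v * fps_deriv F =
      v * fps_sqrt_linear d * (u * fps_deriv (fps_sqrt_linear c))
      + u * fps_sqrt_linear c * (v * fps_deriv (fps_sqrt_linear d))"
    by (simp add: F_def algebra_simps)
  also have "u * fps_deriv (fps_sqrt_linear c) = fps_const (c/2) * fps_sqrt_linear c"
    unfolding u_def by (rule fps_sqrt_linear_deriv)
  also have "v * fps_deriv (fps_sqrt_linear d) = fps_const (d/2) * fps_sqrt_linear d"
    unfolding v_def by (rule fps_sqrt_linear_deriv)
  also have "v * fps_sqrt_linear d * (fps_const (c/2) * fps_sqrt_linear c)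
      + u * fps_sqrt_linear c * (fps_const (d/2) * fps_sqrt_linear d)
      = (fps_const (c/2) * v + fps_const (d/2) * u) * F"
    unfolding F_def by (simp only: algebra_simps)
  also have "fps_const (c/2) * v + fps_const (d/2) * u = fps_X - fps_const x"
  proof -
    have "fps_const (c/2) * v + fps_const (d/2) * u
        = fps_const ((c + d) / 2) + fps_const (c * d) * fps_X"
      by (rule fps_ext) (auto simp: u_def v_def distrib_left field_simps simp flip: mult.assoc)
    then show ?thesis using assms by (simp add: algebra_simps)
  qed
  also have "u * v = 1 - fps_const (2 * x) * fps_X + fps_X * fps_X"
  proof -
    have "u * v = 1 + fps_const (c + d) * fps_X + fps_const (c * d) * (fps_X * fps_X)"
      by (simp add: u_def v_def algebra_simps flip: fps_const_add fps_const_mult)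
    moreover have "fps_const (c + d) = - fps_const (2 * x)" by (simp add: assms)
    ultimately show ?thesis by (simp add: assms)
  qed
  finally show ?thesis .
qed

text \<open>
  Comparing coefficients in the differential equation yields
  \<open>(k + 2) F\<^sub>k\<^sub>+\<^sub>2 = (2 k + 1) x F\<^sub>k\<^sub>+\<^sub>1 - (k - 1) F\<^sub>k\<close>. The
  claim follows by induction: clear the denominators \<open>m + 2\<close> and \<open>m + 3\<close> and use Bonnet's recursion
  at \<open>m\<close> and at \<open>m + 1\<close>.
\<close>

lemma fps_sqrt_linear_product_nth:
  fixes c d x :: real
  assumes "c + d = - 2 * x" "c * d = 1"
  defines "F \<equiv> fps_sqrt_linear c * fps_sqrt_linear d"
  shows "fps_nth F 0 = 1" "fps_nth F (Suc 0) = - x"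
    and "fps_nth F (n + 2) =
           (poly (legendre_poly n) x - x * poly (legendre_poly (n + 1)) x) / (real n + 2)"
proof -
  have coeff: "fps_nth ((1 - fps_const (2 * x) * fps_X + fps_X * fps_X) * fps_deriv F) n
     = fps_nth ((fps_X - fps_const x) * F) n" for n
    unfolding F_def by (simp only: fps_sqrt_linear_product_ode [OF assms(1,2)])
  show F0: "fps_nth F 0 = 1" by (simp add: F_def fps_sqrt_linear_def)
  show F1: "fps_nth F (Suc 0) = - x"
    using coeff [of 0] F0 by simp
  have rec: "(real k + 2) * fps_nth F (k + 2) =
     (2 * real k + 1) * x * fps_nth F (k + 1) - (real k - 1) * fps_nth F k" for k
    using coeff [of "Suc k"]
    by (cases k) (simp_all add: distrib_right left_diff_distrib mult.assoc numeral_2_eq_2, simp_all add: algebra_simps)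
  show "fps_nth F (n + 2) =
           (poly (legendre_poly n) x - x * poly (legendre_poly (n + 1)) x) / (real n + 2)"
  proof (induction n rule: induct_nat_012)
    case 0
    show ?case using rec [of 0] F0 F1 by simp
  next
    \<comment> \<open>At \<open>k = 1\<close> the factor \<open>k - 1\<close> removes the linear coefficient, which is not of the claimed form.\<close>
    case 1
    have F2: "fps_nth F 2 = (1 - x * x) / 2" using rec [of 0] F0 F1 by (simp add: numeral_2_eq_2)
    have "fps_nth F (1 + 2) = x * fps_nth F 2" using rec [of 1] by (simp add: numeral_2_eq_2)
    then show ?case unfolding F2 by (simp add: field_simps)
  next
    case (ge2 m)
    let ?P = "\<lambda>j. poly (legendre_poly j) x"
    have "(real m + 4) * fps_nth F (m + 4) =
        (2 * real m + 5) * x * fps_nth F (m + 3) - (real m + 1) * fps_nth F (m + 2)"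
      using rec [of "m + 2"] by (simp add: algebra_simps eval_nat_numeral)
    moreover have "fps_nth F (m + 3) = (?P (m + 1) - x * ?P (m + 2)) / (real m + 3)"
      using ge2(2) by (simp add: eval_nat_numeral add_ac)
    moreover have "(real m + 1) * fps_nth F (m + 2) = x * ?P (m + 1) - ?P (m + 2)"
    proof -
      have "(real m + 2) * fps_nth F (m + 2) = ?P m - x * ?P (m + 1)"
        using ge2(1) by simp
      then have "(real m + 2) * ((real m + 1) * fps_nth F (m + 2))
          = (real m + 1) * (?P m - x * ?P (m + 1))"
        by (simp add: mult.left_commute)
      also have "\<dots> = (real m + 2) * (x * ?P (m + 1) - ?P (m + 2))"
        using legendre_bonnet [of m x] by (simp add: algebra_simps del: legendre_poly.simps)
      finally show ?thesis by simp
    qed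
    ultimately have "(real m + 4) * fps_nth F (m + 4) =
        (2 * real m + 5) * x * ((?P (m + 1) - x * ?P (m + 2)) / (real m + 3))
          - (x * ?P (m + 1) - ?P (m + 2))"
      by (simp only:)
    then have "(real m + 3) * ((real m + 4) * fps_nth F (m + 4)) =
        (2 * real m + 5) * x * (?P (m + 1) - x * ?P (m + 2))
          - (real m + 3) * (x * ?P (m + 1) - ?P (m + 2))"
      by (simp only: right_diff_distrib [of "real m + 3"]) simp
    also have "\<dots> = (real m + 3) * ?P (m + 2)
        - x * ((2 * real m + 5) * x * ?P (m + 2) - (real m + 2) * ?P (m + 1))"
      by (simp add: algebra_simps del: legendre_poly.simps)
    also have "(2 * real m + 5) * x * ?P (m + 2) - (real m + 2) * ?P (m + 1)
        = (real m + 3) * ?P (m + 3)"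
      using legendre_bonnet [of "m + 1" x]
      by (simp add: algebra_simps eval_nat_numeral del: legendre_poly.simps)
    also have "(real m + 3) * ?P (m + 2) - x * ((real m + 3) * ?P (m + 3))
        = (real m + 3) * (?P (m + 2) - x * ?P (m + 3))"
      by (simp add: algebra_simps del: legendre_poly.simps)
    finally have "(real m + 4) * fps_nth F (m + 4) = ?P (m + 2) - x * ?P (m + 3)" by simp
    then show ?case by (simp add: field_simps eval_nat_numeral del: legendre_poly.simps)
  qed
qed

text \<open>
  Put \<open>s = sqrt (x\<^sup>2 - 1)\<close>. Since \<open>(x + s) (x - s) = 1\<close>, the radius \<open>x - s\<close> is \<open>1 / (x + s)\<close>, so both
  binomial series, in \<open>(x + s) e\<close> and in \<open>(x - s) e\<close>, converge absolutely and may be multiplied.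
  The sign \<open>(-1)\<^sup>k\<close> comes from evaluating the formal root of \<open>1 - 2 x X + X\<^sup>2\<close> at \<open>- e\<close>.
\<close>

lemma sqrt_quadratic_legendre_tail:
  fixes x e :: real
  assumes x: "x \<ge> 1" and e: "\<bar>e\<bar> < x - sqrt (x\<^sup>2 - 1)"
  shows "(\<lambda>j. (-1) ^ (j + 2) *
            ((poly (legendre_poly (j + 2)) x - poly (legendre_poly j) x) / (2 * real (j + 2) - 1))
            * e ^ (j + 2)) sums (1 + x * e - sqrt (1 + 2 * x * e + e\<^sup>2))"
proof -
  define s where "s = sqrt (x\<^sup>2 - 1)"
  define c where "c = - (x + s)"
  define d where "d = - (x - s)"
  define F where "F = fps_sqrt_linear c * fps_sqrt_linear d"
  have s: "s \<ge> 0" "s\<^sup>2 = x\<^sup>2 - 1" using x by (simp_all add: s_def)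
  have cd: "c + d = - 2 * x" "c * d = 1"
    using s by (simp_all add: c_def d_def algebra_simps power2_eq_square)
  have "\<bar>c * - e\<bar> < 1"
  proof -
    have "\<bar>c\<bar> * \<bar>e\<bar> < \<bar>c\<bar> * (x - s)"
      using e x s by (intro mult_strict_left_mono) (auto simp: c_def simp flip: s_def)
    also have "\<dots> = 1" using s x by (simp add: c_def algebra_simps power2_eq_square)
    finally show ?thesis by (simp add: abs_mult)
  qed
  moreover have "\<bar>d * - e\<bar> \<le> \<bar>c * - e\<bar>"
    using x s e by (auto simp: abs_mult c_def d_def simp flip: s_def intro!: mult_right_mono)
  ultimately have small: "\<bar>c * - e\<bar> < 1" "\<bar>d * - e\<bar> < 1" by auto
  have "(\<lambda>n. \<Sum>i\<le>n. ((1/2) gchoose i) * (c * - e) ^ i * (((1/2) gchoose (n - i)) * (d * - e) ^ (n - i)))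
      sums ((\<Sum>k. ((1/2) gchoose k) * (c * - e) ^ k) * (\<Sum>k. ((1/2) gchoose k) * (d * - e) ^ k))"
    by (rule Cauchy_product_sums) (rule sqrt_binomial_summable_norm small)+
  also have "(\<Sum>k. ((1/2) gchoose k) * (c * - e) ^ k) = sqrt (1 + c * - e)"
    using sqrt_binomial_sums [OF small(1)] by (rule sums_unique [symmetric])
  also have "(\<Sum>k. ((1/2) gchoose k) * (d * - e) ^ k) = sqrt (1 + d * - e)"
    using sqrt_binomial_sums [OF small(2)] by (rule sums_unique [symmetric])
  also have "sqrt (1 + c * - e) * sqrt (1 + d * - e) = sqrt (1 + 2 * x * e + e\<^sup>2)"
  proof -
    have "(1 + c * - e) * (1 + d * - e) = 1 - (c + d) * e + (c * d) * e\<^sup>2"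
      by (simp add: algebra_simps power2_eq_square)
    then show ?thesis by (simp add: cd flip: real_sqrt_mult)
  qed
  also have "(\<lambda>n. \<Sum>i\<le>n. ((1/2) gchoose i) * (c * - e) ^ i * (((1/2) gchoose (n - i)) * (d * - e) ^ (n - i)))
      = (\<lambda>n. fps_nth F n * (- e) ^ n)"
  proof
    fix n
    have "((1/2) gchoose i) * (c * - e) ^ i * (((1/2) gchoose (n - i)) * (d * - e) ^ (n - i))
       = ((1/2) gchoose i) * c ^ i * (((1/2) gchoose (n - i)) * d ^ (n - i)) * (- e) ^ n"
      if "i \<le> n" for i
    proof -
      have "(- e) ^ n = (- e) ^ i * (- e) ^ (n - i)" using that by (simp flip: power_add)
      then show ?thesis by (simp only: power_mult_distrib mult_ac)
    qed
    then show "(\<Sum>i\<le>n. ((1/2) gchoose i) * (c * - e) ^ i * (((1/2) gchoose (n - i)) * (d * - e) ^ (n - i)))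
      = fps_nth F n * (- e) ^ n"
      by (simp only: F_def fps_mult_nth fps_sqrt_linear_def fps_nth_Abs_fps sum_distrib_right
            atLeast0AtMost) (rule sum.cong, auto)
  qed
  finally have series: "(\<lambda>n. fps_nth F n * (- e) ^ n) sums sqrt (1 + 2 * x * e + e\<^sup>2)" .
  have "(\<Sum>i<2. fps_nth F i * (- e) ^ i) = 1 + x * e"
    using fps_sqrt_linear_product_nth(1,2) [OF cd] by (simp add: F_def numeral_2_eq_2)
  with sums_split_initial_segment [OF series, of 2]
  have "(\<lambda>j. fps_nth F (j + 2) * (- e) ^ (j + 2))
      sums (sqrt (1 + 2 * x * e + e\<^sup>2) - (1 + x * e))"
    by (simp only:)
  from sums_minus [OF this]
  have "(\<lambda>j. - (fps_nth F (j + 2) * (- e) ^ (j + 2))) sums (1 + x * e - sqrt (1 + 2 * x * e + e\<^sup>2))"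
    by simp
  moreover have "fps_nth F (j + 2) =
      - ((poly (legendre_poly (j + 2)) x - poly (legendre_poly j) x) / (2 * real (j + 2) - 1))" for j
    unfolding F_def fps_sqrt_linear_product_nth(3) [OF cd] legendre_step_eq_difference by simp
  moreover have "(- e) ^ (j + 2) = (- 1) ^ (j + 2) * e ^ (j + 2)" for j
    by (rule power_minus)
  ultimately show ?thesis by (simp only: mult_minus_left mult_minus_right minus_minus mult_ac)
qed

section \<open>The optimal threshold in the three cases\<close>

lemma initial_deficit_bounds:
  assumes "left_response rL"
  shows "0 \<le> 1 - R_T \<gamma> rL r 0" "1 - R_T \<gamma> rL r 0 \<le> 1"
proof -
  have "0 \<le> R_T \<gamma> rL r 0" unfolding R_T_at_zero
    by (intro divide_nonneg_pos left_integral_bounds(1) [OF assms] mills_ratio_pos)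
  then show "1 - R_T \<gamma> rL r 0 \<le> 1" by simp
  have "R_T \<gamma> rL r 0 \<le> 1"
    unfolding R_T_at_zero divide_le_eq_1_pos [OF mills_ratio_pos]
    by (rule left_integral_bounds(2) [OF assms])
  then show "0 \<le> 1 - R_T \<gamma> rL r 0" by simp
qed

text \<open>
  Moving the factor \<open>t / 2\<close> under the root exhibits \<open>w\<close> as the nonnegative root of
  \<open>w\<^sup>2 + t (1 + \<epsilon>) w = t \<epsilon>\<close>, which is the balance equation in the case \<open>\<alpha> = -1\<close>.
\<close>

lemma eta_opt_neg_two:
  fixes \<delta> B \<epsilon> t :: real
  assumes \<delta>: "\<delta> > 0" and rL: "left_response rL"
    and r: "\<forall>x\<ge>0. r x = exp (- \<delta> * x)" and \<gamma>: "\<gamma> = - 2 * \<delta>"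
    and B: "B = std_normal_cdf \<gamma> / std_normal_density \<gamma>"
    and \<epsilon>: "\<epsilon> = 1 - R_T \<gamma> rL r 0" and t: "t = - \<gamma> * B / (1 + \<gamma> * B)" "t > 0"
  defines "w \<equiv> 1/2 * t * (sqrt ((1 + \<epsilon>)\<^sup>2 + 4 * \<epsilon> / t) - 1 - \<epsilon>)"
  shows "w < 1" "eta_opt \<gamma> rL r = - (1 / \<delta>) * ln (1 - w)"
proof -
  have \<epsilon>01: "0 \<le> \<epsilon>" "\<epsilon> \<le> 1" unfolding \<epsilon> by (rule initial_deficit_bounds [OF rL])+
  have R: "R_T \<gamma> rL r 0 = 1 - \<epsilon>" using \<epsilon> by simp
  have D: "1 + \<gamma> * B > 0" unfolding B by (rule mills_ratio_lower_bound)
  \<comment> \<open>\<open>2 p\<close> is the linear coefficient of the quadratic for \<open>w\<close>.\<close>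
  define p where "p = t * (1 + \<epsilon>) / 2"
  have "w = sqrt (p\<^sup>2 + t * \<epsilon>) - p"
  proof -
    have "p\<^sup>2 + t * \<epsilon> = (t / 2)\<^sup>2 * ((1 + \<epsilon>)\<^sup>2 + 4 * \<epsilon> / t)"
      using t(2) by (simp add: p_def field_simps power2_eq_square)
    then have "sqrt (p\<^sup>2 + t * \<epsilon>) = t / 2 * sqrt ((1 + \<epsilon>)\<^sup>2 + 4 * \<epsilon> / t)"
      using t(2) by (simp only: real_sqrt_mult real_sqrt_abs)
    then show ?thesis by (simp add: w_def p_def algebra_simps)
  qed
  note root = quadratic_root_bounds [OF _ _ _ this]
  have "2 * p = t + t * \<epsilon>" by (simp add: p_def distrib_left)
  moreover have "0 \<le> t * \<epsilon>" using t(2) \<epsilon>01 by simp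
  ultimately have pq: "0 \<le> p" "0 \<le> t * \<epsilon>" "t * \<epsilon> < 1 + 2 * p"
    using t(2) by linarith+
  note w = root [OF pq]
  show "w < 1" by (rule w(2))
  have "(1 - \<epsilon>) * B + exp_primitive (- \<delta>) (- (1 / \<delta>) * ln (1 - w))
      = (1 - w) * (B + exp_primitive (- 2 * \<delta>) (- (1 / \<delta>) * ln (1 - w)))"
  proof (rule balance_neg_one [OF \<delta> _ w(2)])
    show "1 - 2 * \<delta> * B > 0" using D by (simp add: \<gamma>)
    show "t = 2 * \<delta> * B / (1 - 2 * \<delta> * B)" using t(1) by (simp add: \<gamma>)
    show "w\<^sup>2 + t * (1 + \<epsilon>) * w = t * \<epsilon>" using w(3) by (simp add: p_def)
  qed
  moreover have "\<gamma> + \<delta> = - \<delta>" by (simp add: \<gamma>)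
  ultimately show "eta_opt \<gamma> rL r = - (1 / \<delta>) * ln (1 - w)"
    by (intro eta_opt_eq_log [OF \<delta> rL r] w) (simp only: \<gamma> R [unfolded \<gamma>] B [unfolded \<gamma>, symmetric])
qed

text \<open>
  The choice \<open>x = 1 + 2 / t\<close> turns the radicand into \<open>1 + 2 x e + e\<^sup>2\<close>, and the term \<open>x e\<close> split off
  from its expansion combines with \<open>- e\<close> to \<open>2 e / t\<close>.
\<close>

lemma legendre_expansion:
  fixes t x e :: real
  assumes t: "t > 0" and x: "x = 1 + 2 / t" and e: "\<bar>e\<bar> < x - sqrt (x\<^sup>2 - 1)"
  defines "c \<equiv> \<lambda>k. (-1) ^ k *
      ((poly (legendre_poly k) x - poly (legendre_poly (k - 2)) x) / (2 * real k - 1)) * e ^ k"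
  shows "summable (\<lambda>j. c (j + 2))"
    and "1/2 * t * (sqrt ((1 + e)\<^sup>2 + 4 * e / t) - 1 - e) = e - 1/2 * t * (\<Sum>j. c (j + 2))"
proof -
  have "x \<ge> 1" using t x by simp
  from sqrt_quadratic_legendre_tail [OF this e]
  have s: "(\<lambda>j. c (j + 2)) sums (1 + x * e - sqrt (1 + 2 * x * e + e\<^sup>2))"
    unfolding c_def by (simp only: diff_add_inverse2)
  then show "summable (\<lambda>j. c (j + 2))" by (rule sums_summable)
  have "(1 + e)\<^sup>2 + 4 * e / t = 1 + 2 * x * e + e\<^sup>2"
    using t by (simp add: x field_simps power2_eq_square)
  moreover have "1/2 * t * (sqrt (1 + 2 * x * e + e\<^sup>2) - 1 - e)
      = e - 1/2 * t * (1 + x * e - sqrt (1 + 2 * x * e + e\<^sup>2))"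
    using t by (simp add: x field_simps)
  ultimately show "1/2 * t * (sqrt ((1 + e)\<^sup>2 + 4 * e / t) - 1 - e)
      = e - 1/2 * t * (\<Sum>j. c (j + 2))"
    using sums_unique [OF s] by simp
qed

text \<open>
  The factor \<open>v\<close> of the closed form is the nonnegative root of the quadratic \<open>v\<^sup>2 + 2 t v = t \<epsilon>\<close>.
  Since \<open>1 / (1 + \<gamma> B) = 1 + t\<close>, this quadratic turns \<open>w\<close> into \<open>2 v - v\<^sup>2\<close>, so \<open>1 - w\<close> is the square of
  \<open>1 - v\<close>.
\<close>

lemma eta_opt_neg_half:
  fixes \<delta> B \<epsilon> t :: real
  assumes \<delta>: "\<delta> > 0" and rL: "left_response rL"
    and r: "\<forall>x\<ge>0. r x = exp (- \<delta> * x)" and \<gamma>: "\<gamma> = - \<delta> / 2"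
    and B: "B = std_normal_cdf \<gamma> / std_normal_density \<gamma>"
    and \<epsilon>: "\<epsilon> = 1 - R_T \<gamma> rL r 0" and t: "t = - \<gamma> * B / (1 + \<gamma> * B)" "t > 0"
  defines "w \<equiv> 2 * t / (1 + \<gamma> * B) * (sqrt (1 + \<epsilon> / t) - 1) - t * \<epsilon>"
  shows "w < 1" "eta_opt \<gamma> rL r = - (1 / \<delta>) * ln (1 - w)"
proof -
  have \<epsilon>01: "0 \<le> \<epsilon>" "\<epsilon> \<le> 1" unfolding \<epsilon> by (rule initial_deficit_bounds [OF rL])+
  have R: "R_T \<gamma> rL r 0 = 1 - \<epsilon>" using \<epsilon> by simp
  have D: "1 + \<gamma> * B > 0" unfolding B by (rule mills_ratio_lower_bound)
  have t1: "1 / (1 + \<gamma> * B) = 1 + t" using D by (simp add: t(1) field_simps)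
  define v where "v = t * (sqrt (1 + \<epsilon> / t) - 1)"
  have "v = sqrt (t\<^sup>2 + t * \<epsilon>) - t"
  proof -
    have "t\<^sup>2 + t * \<epsilon> = t\<^sup>2 * (1 + \<epsilon> / t)" using t(2) by (simp add: field_simps power2_eq_square)
    then have "sqrt (t\<^sup>2 + t * \<epsilon>) = t * sqrt (1 + \<epsilon> / t)"
      using t(2) by (simp only: real_sqrt_mult real_sqrt_abs)
    then show ?thesis by (simp add: v_def algebra_simps)
  qed
  note root = quadratic_root_bounds [OF _ _ _ this]
  have "0 \<le> t" "0 \<le> t * \<epsilon>" "t * \<epsilon> < 1 + 2 * t"
    using t(2) \<epsilon>01 mult_left_le [of \<epsilon> t] by (simp, simp, linarith)
  note v = root [OF this]
  have w_v: "1 - w = (1 - v)\<^sup>2"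
  proof -
    have "w = 2 * (1 / (1 + \<gamma> * B)) * v - t * \<epsilon>" by (simp add: w_def v_def)
    also have "\<dots> = 2 * (1 + t) * v - t * \<epsilon>" unfolding t1 ..
    also have "\<dots> = 2 * v - v\<^sup>2" using v(3) by (simp add: algebra_simps)
    finally show ?thesis by (simp add: power2_eq_square algebra_simps)
  qed
  have w: "0 \<le> w" "w < 1"
  proof -
    have "0 < (1 - v)\<^sup>2" "(1 - v)\<^sup>2 \<le> 1" using v(1,2) by (auto simp: power_le_one)
    then show "0 \<le> w" "w < 1" unfolding w_v [symmetric] by auto
  qed
  show "w < 1" by (rule w(2))
  have "(1 - \<epsilon>) * B + exp_primitive (\<delta> / 2) (- (1 / \<delta>) * ln ((1 - v)\<^sup>2))
      = (1 - v)\<^sup>2 * (B + exp_primitive (- \<delta> / 2) (- (1 / \<delta>) * ln ((1 - v)\<^sup>2)))"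
  proof (rule balance_half [OF \<delta> _ v(2) _ v(3)])
    show "1 - \<delta> * B / 2 > 0" using D by (simp add: \<gamma>)
    show "t = (\<delta> * B / 2) / (1 - \<delta> * B / 2)" using t(1) by (simp add: \<gamma>)
  qed
  moreover have "\<gamma> + \<delta> = \<delta> / 2" by (simp add: \<gamma>)
  ultimately show "eta_opt \<gamma> rL r = - (1 / \<delta>) * ln (1 - w)"
    by (intro eta_opt_eq_log [OF \<delta> rL r] w)
       (simp only: \<gamma> w_v R [unfolded \<gamma>] B [unfolded \<gamma>, symmetric])
qed

lemma binomial_expansion_neg_half:
  fixes t b e :: real
  assumes t: "t > 0" and t1: "1 / (1 + b) = 1 + t" and e: "\<bar>e\<bar> < t"
  defines "c \<equiv> \<lambda>k. ((1/2) gchoose k) * (e / t) ^ k"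
  shows "summable (\<lambda>j. c (j + 2))"
    and "2 * t / (1 + b) * (sqrt (1 + e / t) - 1) - t * e = e + 2 * t / (1 + b) * (\<Sum>j. c (j + 2))"
proof -
  have "\<bar>e / t\<bar> < 1" using e t by (simp add: field_simps)
  from sqrt_binomial_tail [OF this]
  have s: "(\<lambda>j. c (j + 2)) sums (sqrt (1 + e / t) - 1 - e / t / 2)" unfolding c_def .
  then show "summable (\<lambda>j. c (j + 2))" by (rule sums_summable)
  \<comment> \<open>The first-order term of the closed form is \<open>(1 + t) e - t e = e\<close>.\<close>
  have "e + 2 * t / (1 + b) * (sqrt (1 + e / t) - 1 - e / t / 2)
      = 2 * t / (1 + b) * (sqrt (1 + e / t) - 1) + e - e * (1 / (1 + b))"
    using t by (simp add: right_diff_distrib)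
  also have "\<dots> = 2 * t / (1 + b) * (sqrt (1 + e / t) - 1) - t * e"
    unfolding t1 by (simp add: algebra_simps)
  finally show "2 * t / (1 + b) * (sqrt (1 + e / t) - 1) - t * e
      = e + 2 * t / (1 + b) * (\<Sum>j. c (j + 2))"
    using sums_unique [OF s] by simp
qed

lemma eta_opt_one:
  fixes \<delta> B \<epsilon> :: real
  assumes \<delta>: "\<delta> > 0" and rL: "left_response rL"
    and r: "\<forall>x\<ge>0. r x = exp (- \<delta> * x)" and \<gamma>: "\<gamma> = \<delta>"
    and B: "B = std_normal_cdf \<gamma> / std_normal_density \<gamma>" and \<epsilon>: "\<epsilon> = 1 - R_T \<gamma> rL r 0"
  defines "w \<equiv> - \<gamma> * B + sqrt ((\<gamma> * B)\<^sup>2 + 2 * \<gamma> * B * \<epsilon>)"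
  shows "w < 1" "eta_opt \<gamma> rL r = - (1 / \<delta>) * ln (1 - w)"
proof -
  have \<epsilon>01: "0 \<le> \<epsilon>" "\<epsilon> \<le> 1" unfolding \<epsilon> by (rule initial_deficit_bounds [OF rL])+
  have R: "R_T \<gamma> rL r 0 = 1 - \<epsilon>" using \<epsilon> by simp
  define b where "b = \<gamma> * B"
  have b: "b > 0" unfolding b_def B using mills_ratio_pos [of \<gamma>] \<delta> \<gamma> by (intro mult_pos_pos) simp_all
  have "w = sqrt (b\<^sup>2 + 2 * b * \<epsilon>) - b" by (simp add: w_def b_def mult.assoc)
  note root = quadratic_root_bounds [OF _ _ _ this]
  have "0 \<le> b" "0 \<le> 2 * b * \<epsilon>" "2 * b * \<epsilon> < 1 + 2 * b"
    using b \<epsilon>01 mult_left_le [of \<epsilon> b] by (simp, simp, linarith)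
  note w = root [OF this]
  show "w < 1" by (rule w(2))
  have "(1 - \<epsilon>) * B + exp_primitive (2 * \<delta>) (- (1 / \<delta>) * ln (1 - w))
      = (1 - w) * (B + exp_primitive \<delta> (- (1 / \<delta>) * ln (1 - w)))"
    by (rule balance_two [OF \<delta> w(2)]) (use w(3) in \<open>simp only: b_def \<gamma>\<close>)
  moreover have "\<gamma> + \<delta> = 2 * \<delta>" by (simp add: \<gamma>)
  ultimately show "eta_opt \<gamma> rL r = - (1 / \<delta>) * ln (1 - w)"
    by (intro eta_opt_eq_log [OF \<delta> rL r] w) (simp only: \<gamma> R [unfolded \<gamma>] B [unfolded \<gamma>, symmetric])
qed

lemma binomial_expansion_one:
  fixes b e :: real
  assumes e: "\<bar>e\<bar> < b / 2"
  defines "c \<equiv> \<lambda>k. ((1/2) gchoose k) * (2 * e / b) ^ k"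
  shows "summable (\<lambda>j. c (j + 2))"
    and "- b + sqrt (b\<^sup>2 + 2 * b * e) = e + b * (\<Sum>j. c (j + 2))"
proof -
  have b: "b > 0" using e by linarith
  have "\<bar>2 * e / b\<bar> = 2 * \<bar>e\<bar> / b" using b by (simp add: abs_mult)
  then have "\<bar>2 * e / b\<bar> < 1" using b e by simp
  from sqrt_binomial_tail [OF this]
  have s: "(\<lambda>j. c (j + 2)) sums (sqrt (1 + 2 * e / b) - 1 - 2 * e / b / 2)" unfolding c_def .
  then show "summable (\<lambda>j. c (j + 2))" by (rule sums_summable)
  have "b\<^sup>2 + 2 * b * e = b\<^sup>2 * (1 + 2 * e / b)"
    using b by (simp add: field_simps power2_eq_square)
  then have "sqrt (b\<^sup>2 + 2 * b * e) = b * sqrt (1 + 2 * e / b)"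
    using b by (simp only: real_sqrt_mult real_sqrt_abs)
  moreover have "- b + b * sqrt (1 + 2 * e / b) = e + b * (sqrt (1 + 2 * e / b) - 1 - 2 * e / b / 2)"
    using b by (simp add: right_diff_distrib)
  ultimately show "- b + sqrt (b\<^sup>2 + 2 * b * e) = e + b * (\<Sum>j. c (j + 2))"
    using sums_unique [OF s] by simp
qed

theorem proposition19:
  fixes \<delta> \<gamma> \<alpha> B \<epsilon> t :: real and rL rR r :: "real \<Rightarrow> real"
  assumes "\<delta> > 0"
    and "left_response rL"
    and "\<And>x. x \<ge> 0 \<Longrightarrow> rR x = exp (- \<delta> * x)"
    and "\<And>x. x \<le> 0 \<Longrightarrow> r x = rL x"
    and "\<And>x. x \<ge> 0 \<Longrightarrow> r x = rR x"
    and "\<alpha> = (\<gamma> + \<delta>) / \<delta>"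
    and "B = std_normal_cdf \<gamma> / std_normal_density \<gamma>"
    and "\<epsilon> = 1 - R_T \<gamma> rL r 0"
    and "t = - \<gamma> * B / (1 + \<gamma> * B)"
  shows "(\<exists>!\<eta>. threshold_solution \<gamma> rL r \<eta>) \<and>
    (\<alpha> = -1 \<longrightarrow> t > 0 \<and>
      (let w = (\<lambda>e. 1/2 * t * (sqrt ((1 + e)\<^sup>2 + 4 * e / t) - 1 - e));
           x = 1 + 2 / t
       in w \<epsilon> < 1 \<and> eta_opt \<gamma> rL r = - (1 / \<delta>) * ln (1 - w \<epsilon>) \<and>
          (\<forall>e. \<bar>e\<bar> < x - sqrt (x\<^sup>2 - 1) \<longrightarrow>
            (let c = (\<lambda>k. (-1) ^ k *
                   ((poly (legendre_poly k) x - poly (legendre_poly (k - 2)) x) /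
                    (2 * real k - 1)) * e ^ k)
             in summable (\<lambda>j. c (j + 2)) \<and> w e = e - 1/2 * t * (\<Sum>j. c (j + 2)))))) \<and>
    (\<alpha> = 1/2 \<longrightarrow> t > 0 \<and>
      (let w = (\<lambda>e. 2 * t / (1 + \<gamma> * B) * (sqrt (1 + e / t) - 1) - t * e)
       in w \<epsilon> < 1 \<and> eta_opt \<gamma> rL r = - (1 / \<delta>) * ln (1 - w \<epsilon>) \<and>
          (\<forall>e. \<bar>e\<bar> < t \<longrightarrow>
            (let c = (\<lambda>k. ((1/2) gchoose k) * (e / t) ^ k)
             in summable (\<lambda>j. c (j + 2)) \<and>
                w e = e + 2 * t / (1 + \<gamma> * B) * (\<Sum>j. c (j + 2)))))) \<and>
    (\<alpha> = 2 \<longrightarrow>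
      (let w = (\<lambda>e. - \<gamma> * B + sqrt ((\<gamma> * B)\<^sup>2 + 2 * \<gamma> * B * e))
       in w \<epsilon> < 1 \<and> eta_opt \<gamma> rL r = - (1 / \<delta>) * ln (1 - w \<epsilon>) \<and>
          (\<forall>e. \<bar>e\<bar> < 1/2 * \<gamma> * B \<longrightarrow>
            (let c = (\<lambda>k. ((1/2) gchoose k) * (2 * e / (\<gamma> * B)) ^ k)
             in summable (\<lambda>j. c (j + 2)) \<and>
                w e = e + \<gamma> * B * (\<Sum>j. c (j + 2))))))"
proof -
  have r: "\<forall>x\<ge>0. r x = exp (- \<delta> * x)" using assms(3,5) by simp
  have B: "B > 0" and D: "1 + \<gamma> * B > 0"
    using mills_ratio_pos mills_ratio_lower_bound assms(7) by auto
  have t_pos: "t > 0" if "\<gamma> < 0"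
    using that B D unfolding assms(9) by (intro divide_pos_pos mult_pos_pos) auto
  have t1: "1 / (1 + \<gamma> * B) = 1 + t" using D by (simp add: assms(9) field_simps)
  note data = assms(1,2) r
  show ?thesis
  proof (intro conjI impI)
    show "\<exists>!\<eta>. threshold_solution \<gamma> rL r \<eta>" by (rule threshold_solution_ex1 [OF data])
  next
    assume "\<alpha> = -1"
    then have \<gamma>: "\<gamma> = - 2 * \<delta>" using assms(1,6) by (simp add: field_simps)
    show t: "t > 0" using t_pos \<gamma> assms(1) by simp
    note opt = eta_opt_neg_two [OF data \<gamma> assms(7,8,9) t]
    show "let w = (\<lambda>e. 1/2 * t * (sqrt ((1 + e)\<^sup>2 + 4 * e / t) - 1 - e)); x = 1 + 2 / t
      in w \<epsilon> < 1 \<and> eta_opt \<gamma> rL r = - (1 / \<delta>) * ln (1 - w \<epsilon>) \<and>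
        (\<forall>e. \<bar>e\<bar> < x - sqrt (x\<^sup>2 - 1) \<longrightarrow>
          (let c = (\<lambda>k. (-1) ^ k *
                 ((poly (legendre_poly k) x - poly (legendre_poly (k - 2)) x) /
                  (2 * real k - 1)) * e ^ k)
           in summable (\<lambda>j. c (j + 2)) \<and> w e = e - 1/2 * t * (\<Sum>j. c (j + 2))))"
      unfolding Let_def by (intro conjI allI impI opt legendre_expansion [OF t refl])
  next
    assume "\<alpha> = 1/2"
    then have \<gamma>: "\<gamma> = - \<delta> / 2" using assms(1,6) by (simp add: field_simps)
    show t: "t > 0" using t_pos \<gamma> assms(1) by simp
    note opt = eta_opt_neg_half [OF data \<gamma> assms(7,8,9) t]
    show "let w = (\<lambda>e. 2 * t / (1 + \<gamma> * B) * (sqrt (1 + e / t) - 1) - t * e)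
      in w \<epsilon> < 1 \<and> eta_opt \<gamma> rL r = - (1 / \<delta>) * ln (1 - w \<epsilon>) \<and>
        (\<forall>e. \<bar>e\<bar> < t \<longrightarrow>
          (let c = (\<lambda>k. ((1/2) gchoose k) * (e / t) ^ k)
           in summable (\<lambda>j. c (j + 2)) \<and> w e = e + 2 * t / (1 + \<gamma> * B) * (\<Sum>j. c (j + 2))))"
      unfolding Let_def by (intro conjI allI impI opt binomial_expansion_neg_half [OF t t1])
  next
    assume "\<alpha> = 2"
    then have \<gamma>: "\<gamma> = \<delta>" using assms(1,6) by (simp add: field_simps)
    note opt = eta_opt_one [OF data \<gamma> assms(7,8)]
    have "\<bar>e\<bar> < \<gamma> * B / 2" if "\<bar>e\<bar> < 1/2 * \<gamma> * B" for e using that by simp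
    note series = binomial_expansion_one [OF this, folded mult.assoc]
    show "let w = (\<lambda>e. - \<gamma> * B + sqrt ((\<gamma> * B)\<^sup>2 + 2 * \<gamma> * B * e))
      in w \<epsilon> < 1 \<and> eta_opt \<gamma> rL r = - (1 / \<delta>) * ln (1 - w \<epsilon>) \<and>
        (\<forall>e. \<bar>e\<bar> < 1/2 * \<gamma> * B \<longrightarrow>
          (let c = (\<lambda>k. ((1/2) gchoose k) * (2 * e / (\<gamma> * B)) ^ k)
           in summable (\<lambda>j. c (j + 2)) \<and> w e = e + \<gamma> * B * (\<Sum>j. c (j + 2))))"
      unfolding Let_def mult_minus_left by (intro conjI allI impI opt [unfolded mult_minus_left] series)
  qed
qed

end
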